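(* Let $P$ be a probability distribution on $\mathbb{R}^d$. Suppose $K\subset\mathbb{R}^d$ is a star body such that $r_{\mathrm{in}}=r_{\mathrm{ker}}>0$, where $r_{\mathrm{in}}:=\inf_{\mathbf{u}\in\mathbb{S}^{d-1}}\rho_K(\mathbf{u})$ and $r_{\mathrm{ker}}:=\sup\{r>0: rB^d\subseteq\mathrm{ker}(K)\}$. Then for any $\epsilon\ge 0$, $$\sup_{Q:\ W_1(P,Q)\le\epsilon}\mathbb{E}_Q[\|\mathbf{x}\|_K]=\mathbb{E}_P[\|\mathbf{x}\|_K]+\epsilon\cdot\mathrm{Lip}(K).$$
   Context: A star body in $\mathbb{R}^d$ is a compact set $K$ with nonempty interior such that $[\mathbf{0},\mathbf{y}]\subset K$ for every $\mathbf{y}\in K$ and, for every $\mathbf{x}\ne \mathbf{0}$, the ray $\{\lambda\mathbf{x}:\lambda>0\}$ meets the boundary of $K$ exactly once. (Equivalently, its radial function is positive and continuous on the unit sphere $\mathbb{S}^{d-1}$.) The radial function is $\rho_K(\mathbf{u})=\sup\{\lambda\ge0:\lambda\mathbf{u}\in K\}$ and the gauge is $\|\mathbf{x}\|_K=\inf\{\lambda\ge 0:\mathbf{x}\in\lambda K\}$. The kernel of $K$ is $\mathrm{ker}(K)=\{\mathbf{x}\in K:[\mathbf{x},\mathbf{y}]\subset K\ \text{for all}\ \mathbf{y}\in K\}$. $B^d$ is the closed Euclidean unit ball. $\mathrm{Lip}(K):=\inf\{1/r: r>0,\ rB^d\subseteq\mathrm{ker}(K)\}$ (this is the Lipschitz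 constant of $\|\cdot\|_K$ with respect to the Euclidean norm). $W_1(P,Q)=\inf_{\beta\in\Gamma(Q,P)}\mathbb{E}_{(X,Y)\sim\beta}\|X-Y\|_2$ with $\Gamma(Q,P)$ the set of couplings of $Q$ and $P$. *)

theory Defs
  imports "HOL-Probability.Probability"
begin

text \<open>
  All suprema and infima of nonnegative quantities below are taken in the complete lattice
  \<^typ>\<open>ennreal\<close>, i.e. in the interval from \<open>0\<close> to \<open>\<infinity>\<close>. This gives the usual
  conventions that the supremum of the empty set is \<open>0\<close> and its infimum is \<open>\<infinity>\<close>; over
  \<^typ>\<open>real\<close> these values would be unspecified.
\<close>

definition star_body :: "'a::euclidean_space set \<Rightarrow> bool" where
  "star_body K \<longleftrightarrow>
     compact K \<and> interior K \<noteq> {} \<and>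
     (\<forall>y\<in>K. closed_segment 0 y \<subseteq> K) \<and>
     (\<forall>x. x \<noteq> 0 \<longrightarrow> (\<exists>!z. z \<in> {l *\<^sub>R x | l::real. 0 < l} \<inter> frontier K))"

definition radial_fun :: "'a::euclidean_space set \<Rightarrow> 'a \<Rightarrow> ennreal" where
  "radial_fun K u = (SUP l \<in> {l::real. 0 \<le> l \<and> l *\<^sub>R u \<in> K}. ennreal l)"

text \<open>
  The Minkowski gauge of \<open>K\<close>. It is unrelated to the predicate \<^const>\<open>gauge\<close> of
  Henstock-Kurzweil integration.
\<close>

definition star_gauge :: "'a::euclidean_space set \<Rightarrow> 'a \<Rightarrow> ennreal" where
  "star_gauge K x = (INF l \<in> {l::real. 0 \<le> l \<and> x \<in> (\<lambda>y. l *\<^sub>R y) ` K}. ennreal l)"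

definition star_kernel :: "'a::euclidean_space set \<Rightarrow> 'a set" where
  "star_kernel K = {x \<in> K. \<forall>y\<in>K. closed_segment x y \<subseteq> K}"

definition inner_radius :: "'a::euclidean_space set \<Rightarrow> ennreal" where
  "inner_radius K = (INF u \<in> sphere 0 1. radial_fun K u)"

definition kernel_radius :: "'a::euclidean_space set \<Rightarrow> ennreal" where
  "kernel_radius K = (SUP r \<in> {r::real. 0 < r \<and> cball 0 r \<subseteq> star_kernel K}. ennreal r)"

definition star_Lip :: "'a::euclidean_space set \<Rightarrow> ennreal" where
  "star_Lip K = (INF r \<in> {r::real. 0 < r \<and> cball 0 r \<subseteq> star_kernel K}. ennreal (1 / r))"

definition borel_distribution :: "'a::euclidean_space measure \<Rightarrow> bool" where
  "borel_distribution P \<longleftrightarrow> prob_space P \<and> sets P = sets borel"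

definition couplings ::
  "'a::euclidean_space measure \<Rightarrow> 'a measure \<Rightarrow> ('a \<times> 'a) measure set" where
  "couplings Q P =
     {\<beta>. prob_space \<beta> \<and> sets \<beta> = sets (borel \<Otimes>\<^sub>M borel) \<and>
         distr \<beta> borel fst = Q \<and> distr \<beta> borel snd = P}"

definition wasserstein1 :: "'a::euclidean_space measure \<Rightarrow> 'a measure \<Rightarrow> ennreal" where
  "wasserstein1 P Q =
     (INF \<beta> \<in> couplings Q P. \<integral>\<^sup>+ z. ennreal (norm (fst z - snd z)) \<partial>\<beta>)"

end

theory Submission
  imports Defs
begin

text \<open>
  A ball of radius \<open>r\<close> inside the kernel makes the gauge \<open>1/r\<close>-Lipschitz, and integrating this along a
  coupling gives the upper bound. For the lower bound, a fraction \<open>p\<close> of the mass of \<open>P\<close> is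
  translated by \<open>(\<epsilon>/p) u\<close>, at cost \<open>\<epsilon>\<close>. As \<open>p\<close> tends to \<open>0\<close> the translation is so long that the gauge
  of the moved mass is governed by the direction \<open>u\<close> alone, and the gain tends to
  \<open>\<epsilon> / \<rho>\<^sub>K(u)\<close>. The hypothesis on the radii says that the supremum of
  \<open>1 / \<rho>\<^sub>K(u)\<close> over the sphere is the Lipschitz constant.
\<close>

section \<open>Reciprocals, infima and suprema in \<open>ennreal\<close>\<close>

lemma inverse_antimono_ennreal: "antimono (inverse :: ennreal \<Rightarrow> ennreal)"
proof (rule antimonoI)
  fix x y :: ennreal
  assume "x \<le> y"
  then show "inverse y \<le> inverse x"
  proof (cases "x = 0 \<or> y = top")
    case False
    then obtain a b where "x = ennreal a" "y = ennreal b" "0 < a" "0 < b"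
      using \<open>x \<le> y\<close>
      by (cases x; cases y) (auto simp: top_unique ennreal_0[symmetric] simp del: ennreal_0)
    then show ?thesis
      using \<open>x \<le> y\<close> by (simp add: inverse_ennreal ennreal_leI le_imp_inverse_le)
  qed auto
qed

text \<open>An antitone map that is continuous from the left at a supremum sends it to the infimum
  of the images. This and its dual translate between radii and Lipschitz constants.\<close>

lemma inverse_SUP_ennreal:
  fixes f :: "'i \<Rightarrow> ennreal"
  assumes "I \<noteq> {}"
  shows "inverse (SUP i\<in>I. f i) = (INF i\<in>I. inverse (f i))"
proof -
  have "continuous_on UNIV (inverse :: ennreal \<Rightarrow> ennreal)"
    by (intro continuous_intros)
  then have "continuous (at_left (SUP i\<in>I. f i)) inverse"
    by (simp add: continuous_on_eq_continuous_at continuous_at_imp_continuous_at_within)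
  from continuous_at_Sup_antimono[OF inverse_antimono_ennreal this] assms show ?thesis
    by (simp add: image_comp)
qed

lemma inverse_INF_ennreal:
  fixes f :: "'i \<Rightarrow> ennreal"
  assumes "I \<noteq> {}"
  shows "inverse (INF i\<in>I. f i) = (SUP i\<in>I. inverse (f i))"
proof -
  have "continuous_on UNIV (inverse :: ennreal \<Rightarrow> ennreal)"
    by (intro continuous_intros)
  then have "continuous (at_right (INF i\<in>I. f i)) inverse"
    by (simp add: continuous_on_eq_continuous_at continuous_at_imp_continuous_at_within)
  from continuous_at_Inf_antimono[OF inverse_antimono_ennreal this] assms show ?thesis
    by (simp add: image_comp)
qed

text \<open>For finite \<open>c\<close> the affine map is monotone and continuous; for
  \<open>c = top\<close> continuity fails at \<open>0\<close>. The infimum will run over dilation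
  factors, over radii of kernel balls and over couplings.\<close>

lemma add_mult_INF_ennreal:
  fixes a c :: ennreal and f :: "'i \<Rightarrow> ennreal"
  assumes "c < top" "I \<noteq> {}"
  shows "a + c * (INF i\<in>I. f i) = (INF i\<in>I. a + c * f i)"
proof -
  have "continuous_on UNIV (\<lambda>t. a + c * t)"
    by (intro continuous_on_add_ennreal ennreal_continuous_on_cmult assms continuous_intros)
  then have "continuous (at_right (INF i\<in>I. f i)) (\<lambda>t. a + c * t)"
    by (simp add: continuous_on_eq_continuous_at continuous_at_imp_continuous_at_within)
  moreover have "mono (\<lambda>t. a + c * t)"
    by (intro monoI add_left_mono mult_left_mono) auto
  ultimately show ?thesis
    using continuous_at_Inf_mono[of "\<lambda>t. a + c * t" "f ` I"] assms by (simp add: image_comp)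
qed

section \<open>Estimates for the gauge\<close>

lemma star_gauge_scaleR_le:
  assumes "0 \<le> l" "y \<in> K"
  shows "star_gauge K (l *\<^sub>R y) \<le> ennreal l"
  unfolding star_gauge_def using assms by (auto intro: INF_lower)

text \<open>Bounds the first moment of \<open>P\<close> by a multiple of its gauge integral, so that
  an error controlled by the norm is finite whenever the gauge integral is.\<close>

lemma norm_le_star_gauge:
  fixes K :: "'a::euclidean_space set"
  assumes "K \<subseteq> cball 0 R" "0 < R"
  shows "ennreal (norm x / R) \<le> star_gauge K x"
  unfolding star_gauge_def
proof (intro INF_greatest ennreal_leI)
  fix l :: real
  assume "l \<in> {l. 0 \<le> l \<and> x \<in> (*\<^sub>R) l ` K}"
  then obtain y where y: "0 \<le> l" "y \<in> K" "x = l *\<^sub>R y" by auto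
  then have "norm y \<le> R" using assms by auto
  then show "norm x / R \<le> l"
    using y \<open>0 < R\<close> by (simp add: divide_le_eq mult_left_mono)
qed

text \<open>If \<open>x = l k\<close> with \<open>k\<close> in \<open>K\<close> and
  \<open>y = m b\<close> with \<open>b\<close> in the kernel, then \<open>(x + y) / (l + m)\<close>
  is a convex combination of \<open>b\<close> and \<open>k\<close>. It lies in \<open>K\<close>
  because the kernel sees every point of \<open>K\<close>.\<close>

lemma star_gauge_add_le:
  assumes "0 < s" "cball 0 s \<subseteq> star_kernel K"
  shows "star_gauge K (x + y) \<le> star_gauge K x + ennreal (norm y) * ennreal (1 / s)"
proof (cases "y = 0")
  case False
  \<comment> \<open>The gauge of \<open>y\<close> with respect to the ball of radius
    \<open>s\<close>; thus \<open>y / m\<close> lies on the boundary of that ball and so in the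
    kernel.\<close>
  define m where "m = norm y / s"
  have m: "0 < m" using False assms by (simp add: m_def)
  have "star_gauge K (x + y) \<le> ennreal m + ennreal l"
    if l: "0 \<le> l" "x \<in> (*\<^sub>R) l ` K" for l
  proof -
    obtain k where k: "k \<in> K" "x = l *\<^sub>R k" using l by auto
    define b where "b = (1 / m) *\<^sub>R y"
    have "norm b = s" using False assms by (simp add: b_def m_def)
    then have "closed_segment b k \<subseteq> K"
      using assms k by (force simp: star_kernel_def)
    moreover have "(m / (l + m)) *\<^sub>R b + (l / (l + m)) *\<^sub>R k \<in> closed_segment b k"
    proof -
      have "1 - l / (l + m) = m / (l + m)" using l m by (simp add: field_simps)
      then show ?thesis
        unfolding closed_segment_def using l m by (auto intro!: exI[of _ "l / (l + m)"])
    qed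
    ultimately have "(m / (l + m)) *\<^sub>R b + (l / (l + m)) *\<^sub>R k \<in> K" by blast
    then have "star_gauge K ((l + m) *\<^sub>R ((m / (l + m)) *\<^sub>R b + (l / (l + m)) *\<^sub>R k)) \<le> ennreal (l + m)"
      using l m by (intro star_gauge_scaleR_le) auto
    also have "(l + m) *\<^sub>R ((m / (l + m)) *\<^sub>R b + (l / (l + m)) *\<^sub>R k) = x + y"
      using l m by (simp add: b_def k scaleR_add_right)
    finally show ?thesis using l m by (simp add: ennreal_plus add.commute)
  qed
  \<comment> \<open>An admissible dilation factor for \<open>x\<close>, so that the infimum defining
    its gauge is over a nonempty set and commutes with adding \<open>m\<close>.\<close>
  moreover have "x \<in> (*\<^sub>R) (norm x / s) ` K"
  proof (cases "x = 0")
    case True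
    have "0 \<in> cball 0 s" using assms by simp
    then have "0 \<in> K" using assms unfolding star_kernel_def by blast
    then show ?thesis using True by force
  next
    case False
    have "(s / norm x) *\<^sub>R x \<in> K" using assms False by (force simp: star_kernel_def)
    then show ?thesis using assms False by (intro image_eqI) auto
  qed
  then have "{l. 0 \<le> l \<and> x \<in> (*\<^sub>R) l ` K} \<noteq> {}"
    using \<open>0 < s\<close> by (auto intro!: exI[of _ "norm x / s"])
  from add_mult_INF_ennreal[OF _ this, of 1 "ennreal m" ennreal]
  have "star_gauge K x + ennreal m = (INF l\<in>{l. 0 \<le> l \<and> x \<in> (*\<^sub>R) l ` K}. ennreal m + ennreal l)"
    unfolding star_gauge_def by (simp add: add.commute)
  ultimately have "star_gauge K (x + y) \<le> star_gauge K x + ennreal m"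
    by (auto intro: INF_greatest)
  then show ?thesis using assms by (simp add: m_def ennreal_mult[symmetric])
qed simp

lemma star_gauge_finite:
  assumes "0 < s" "cball 0 s \<subseteq> star_kernel K"
  shows "star_gauge K x < top"
proof -
  have "0 \<in> cball 0 s" using assms by simp
  then have "0 \<in> K" using assms unfolding star_kernel_def by blast
  then have "star_gauge K 0 \<le> ennreal 0"
    using star_gauge_scaleR_le[of 0 0 K] by simp
  then have "star_gauge K x \<le> ennreal (norm x) * ennreal (1 / s)"
    using star_gauge_add_le[OF assms, of 0 x] by simp
  also have "\<dots> < top" by (simp add: ennreal_mult_less_top)
  finally show ?thesis .
qed

text \<open>Being finite, the gauge can be read as a real function; there the triangle-type estimate
  makes it Lipschitz, hence continuous.\<close>

lemma borel_measurable_star_gauge: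
  fixes K :: "'a::euclidean_space set"
  assumes "0 < s" "cball 0 s \<subseteq> star_kernel K"
  shows "star_gauge K \<in> borel_measurable borel"
proof -
  define n where "n x = enn2real (star_gauge K x)" for x
  have n: "star_gauge K x = ennreal (n x)" "0 \<le> n x" for x
    using star_gauge_finite[OF assms, of x] by (simp_all add: n_def)
  have le: "n x \<le> n y + (1 / s) * dist x y" for x y
  proof -
    have "ennreal (n x) \<le> ennreal (n y) + ennreal (norm (x - y)) * ennreal (1 / s)"
      using star_gauge_add_le[OF assms, of y "x - y"] by (simp add: n)
    also have "\<dots> = ennreal (n y + (1 / s) * dist x y)"
      using assms n by (simp add: dist_norm flip: ennreal_plus ennreal_mult)
    finally show ?thesis using assms n by (subst (asm) ennreal_le_iff) auto
  qed
  have "(1 / s)-lipschitz_on UNIV n"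
  proof (rule lipschitz_onI)
    show "dist (n x) (n y) \<le> 1 / s * dist x y" for x y
      using le[of x y] le[of y x] by (simp add: dist_real_def dist_commute abs_le_iff)
  qed (use assms in simp)
  then have "n \<in> borel_measurable borel"
    by (intro borel_measurable_continuous_onI lipschitz_on_continuous_on)
  then have "(\<lambda>x. ennreal (n x)) \<in> borel_measurable borel" by measurable
  then show ?thesis by (simp add: n(1)[symmetric])
qed

text \<open>Whenever \<open>t u = l y\<close> with \<open>y\<close> in \<open>K\<close> and
  \<open>t\<close> positive, the point \<open>(t / l) u\<close> lies in \<open>K\<close>, so
  \<open>t / l\<close> is at most the radial function at \<open>u\<close>.\<close>

lemma le_star_gauge_scaleR:
  assumes "0 \<le> t" "u \<noteq> 0"
  shows "ennreal t * inverse (radial_fun K u) \<le> star_gauge K (t *\<^sub>R u)"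
proof (cases "t = 0")
  case False
  show ?thesis unfolding star_gauge_def
  proof (rule INF_greatest)
    fix l :: real
    assume "l \<in> {l. 0 \<le> l \<and> t *\<^sub>R u \<in> (*\<^sub>R) l ` K}"
    then obtain y where y: "0 \<le> l" "y \<in> K" "t *\<^sub>R u = l *\<^sub>R y" by auto
    have l: "0 < l" using y False assms by (cases "l = 0") auto
    have "(t / l) *\<^sub>R u = (1 / l) *\<^sub>R (t *\<^sub>R u)" by simp
    also have "\<dots> = y" using y l by simp
    finally have "(t / l) *\<^sub>R u = y" .
    then have "ennreal (t / l) \<le> radial_fun K u"
      unfolding radial_fun_def using y l assms by (intro SUP_upper) auto
    then have "inverse (radial_fun K u) \<le> inverse (ennreal (t / l))"
      by (rule antimonoD[OF inverse_antimono_ennreal])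
    also have "\<dots> = ennreal (l / t)"
      using l False assms by (subst inverse_ennreal) auto
    finally have "ennreal t * inverse (radial_fun K u) \<le> ennreal t * ennreal (l / t)"
      by (intro mult_left_mono) auto
    also have "\<dots> = ennreal l"
      using l False assms by (simp add: ennreal_mult[symmetric])
    finally show "ennreal t * inverse (radial_fun K u) \<le> ennreal l" .
  qed
qed simp

section \<open>The Lipschitz constant in terms of the radii\<close>

lemma star_Lip_eq_inverse_kernel_radius:
  assumes "0 < kernel_radius K"
  shows "star_Lip K = inverse (kernel_radius K)"
proof -
  have "{r::real. 0 < r \<and> cball 0 r \<subseteq> star_kernel K} \<noteq> {}"
    using assms by (auto simp: kernel_radius_def less_SUP_iff)
  then have "inverse (kernel_radius K)
      = (INF r\<in>{r::real. 0 < r \<and> cball 0 r \<subseteq> star_kernel K}. inverse (ennreal r))"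
    unfolding kernel_radius_def by (rule inverse_SUP_ennreal)
  also have "\<dots> = star_Lip K"
    unfolding star_Lip_def by (intro INF_cong) (auto simp: inverse_ennreal inverse_eq_divide)
  finally show ?thesis by simp
qed

text \<open>When the two radii agree, this presents \<open>star_Lip K\<close> as a supremum over
  directions, so the lower bound can be proved for one direction at a time.\<close>

lemma inverse_inner_radius:
  fixes K :: "'a::euclidean_space set"
  shows "inverse (inner_radius K) = (SUP u\<in>sphere 0 1. inverse (radial_fun K u))"
proof -
  have "(sphere 0 1 :: 'a set) \<noteq> {}" using vector_choose_size[of 1] by auto
  then show ?thesis unfolding inner_radius_def by (rule inverse_INF_ennreal)
qed

text \<open>The estimates for the individual kernel balls pass to the infimum of their constants, so
  no ball of maximal radius has to be produced.\<close>

lemma star_gauge_add_le_Lip: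
  assumes "0 < kernel_radius K"
  shows "star_gauge K (x + y) \<le> star_gauge K x + ennreal (norm y) * star_Lip K"
proof -
  have ne: "{r::real. 0 < r \<and> cball 0 r \<subseteq> star_kernel K} \<noteq> {}"
    using assms by (auto simp: kernel_radius_def less_SUP_iff)
  show ?thesis
    unfolding star_Lip_def
    by (subst add_mult_INF_ennreal[OF _ ne]) (auto intro!: INF_greatest star_gauge_add_le)
qed

section \<open>Upper bound by integration along couplings\<close>

lemma nn_integral_star_gauge_le_wasserstein1:
  fixes K :: "'a::euclidean_space set"
  assumes K: "0 < kernel_radius K"
    and W: "wasserstein1 P Q < top"
  shows "(\<integral>\<^sup>+ x. star_gauge K x \<partial>Q) \<le> (\<integral>\<^sup>+ x. star_gauge K x \<partial>P) + star_Lip K * wasserstein1 P Q"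
proof -
  obtain s where s: "0 < s" "cball 0 s \<subseteq> star_kernel K"
    using K by (auto simp: kernel_radius_def less_SUP_iff)
  note [measurable] = borel_measurable_star_gauge[OF s]
  have Lip: "star_Lip K < top"
    using K by (simp add: star_Lip_eq_inverse_kernel_radius less_top[symmetric])
  \<comment> \<open>The infimum over the empty set is \<open>top\<close>, so a finite distance
    provides a coupling.\<close>
  have ne: "couplings Q P \<noteq> {}"
    using W by (auto simp: wasserstein1_def)
  have "(\<integral>\<^sup>+ x. star_gauge K x \<partial>Q)
      \<le> (\<integral>\<^sup>+ x. star_gauge K x \<partial>P) + star_Lip K * (\<integral>\<^sup>+ z. ennreal (norm (fst z - snd z)) \<partial>\<beta>)"
    if \<beta>: "\<beta> \<in> couplings Q P" for \<beta>
  proof -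
    have [measurable_cong]: "sets \<beta> = sets (borel \<Otimes>\<^sub>M borel)"
      and QP: "Q = distr \<beta> borel fst" "P = distr \<beta> borel snd"
      using \<beta> by (auto simp: couplings_def)
    have "(\<integral>\<^sup>+ x. star_gauge K x \<partial>Q) = (\<integral>\<^sup>+ z. star_gauge K (fst z) \<partial>\<beta>)"
      unfolding QP by (simp add: nn_integral_distr)
    also have "\<dots> \<le> (\<integral>\<^sup>+ z. star_gauge K (snd z) + star_Lip K * ennreal (norm (fst z - snd z)) \<partial>\<beta>)"
      using star_gauge_add_le_Lip[OF K, of "snd z" "fst z - snd z" for z]
      by (intro nn_integral_mono) (simp add: mult.commute)
    also have "\<dots> = (\<integral>\<^sup>+ x. star_gauge K x \<partial>P) + star_Lip K * (\<integral>\<^sup>+ z. ennreal (norm (fst z - snd z)) \<partial>\<beta>)"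
      unfolding QP by (simp add: nn_integral_distr nn_integral_add nn_integral_cmult)
    finally show ?thesis .
  qed
  then show ?thesis
    unfolding wasserstein1_def add_mult_INF_ennreal[OF Lip ne] by (rule INF_greatest)
qed

section \<open>Lower bound by translating part of the mass\<close>

text \<open>Draw a point from \<open>P\<close> and an independent coin with success probability
  \<open>p\<close>, and move the point by \<open>v\<close> on success. The joint law of the new and
  the old point is a coupling of cost \<open>p * norm v\<close>.\<close>

lemma exists_partial_translation:
  fixes P :: "'a::euclidean_space measure"
  assumes P: "borel_distribution P" and p: "0 \<le> p" "p \<le> 1"
  obtains Q where "borel_distribution Q"
    and "wasserstein1 P Q \<le> ennreal (p * norm v)"
    and "\<And>f. f \<in> borel_measurable borel \<Longrightarrow>
      (\<integral>\<^sup>+ x. f x \<partial>Q) = ennreal (1 - p) * (\<integral>\<^sup>+ x. f x \<partial>P) + ennreal p * (\<integral>\<^sup>+ x. f (x + v) \<partial>P)"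
proof -
  define B where "B = measure_pmf (bernoulli_pmf p)"
  interpret P: prob_space P using P by (simp add: borel_distribution_def)
  interpret B: prob_space B unfolding B_def by (rule prob_space_measure_pmf)
  interpret PB: pair_prob_space P B ..
  have setsP[measurable_cong]: "sets P = sets borel" using P by (simp add: borel_distribution_def)
  have [measurable_cong]: "sets B = sets (count_space UNIV)" by (simp add: B_def)
  define T :: "'a \<times> bool \<Rightarrow> 'a \<times> 'a" where
    "T z = (if snd z then fst z + v else fst z, fst z)" for z
  have T[measurable]: "T \<in> P \<Otimes>\<^sub>M B \<rightarrow>\<^sub>M borel \<Otimes>\<^sub>M borel" unfolding T_def by measurable
  define \<beta> where "\<beta> = distr (P \<Otimes>\<^sub>M B) (borel \<Otimes>\<^sub>M borel) T"
  define Q where "Q = distr \<beta> borel fst"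
  have \<beta>[measurable_cong]: "sets \<beta> = sets (borel \<Otimes>\<^sub>M borel)" by (simp add: \<beta>_def)
  interpret \<beta>: prob_space \<beta> unfolding \<beta>_def by (rule PB.P.prob_space_distr[OF T])
  have int: "(\<integral>\<^sup>+ z. g z \<partial>\<beta>)
      = ennreal (1 - p) * (\<integral>\<^sup>+ x. g (x, x) \<partial>P) + ennreal p * (\<integral>\<^sup>+ x. g (x + v, x) \<partial>P)"
    if [measurable]: "g \<in> borel_measurable (borel \<Otimes>\<^sub>M borel)" for g :: "'a \<times> 'a \<Rightarrow> ennreal"
  proof -
    have "(\<integral>\<^sup>+ z. g z \<partial>\<beta>) = (\<integral>\<^sup>+ x. \<integral>\<^sup>+ b. g (T (x, b)) \<partial>B \<partial>P)"
      unfolding \<beta>_def by (subst nn_integral_distr) (simp_all add: B.nn_integral_fst[symmetric])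
    also have "\<dots> = (\<integral>\<^sup>+ x. ennreal (1 - p) * g (x, x) + ennreal p * g (x + v, x) \<partial>P)"
      unfolding B_def using p by (simp add: T_def mult.commute add.commute)
    also have "\<dots> = ennreal (1 - p) * (\<integral>\<^sup>+ x. g (x, x) \<partial>P) + ennreal p * (\<integral>\<^sup>+ x. g (x + v, x) \<partial>P)"
      by (simp add: nn_integral_add nn_integral_cmult)
    finally show ?thesis .
  qed
  \<comment> \<open>The target space is rewritten from \<open>borel\<close> to \<open>P\<close>,
    which has the same measurable sets, to match the form of \<open>distr_pair_fst\<close>.\<close>
  have "distr \<beta> borel snd = distr (P \<Otimes>\<^sub>M B) P fst"
    unfolding \<beta>_def by (subst distr_distr) (auto intro!: distr_cong simp: setsP T_def)
  then have "distr \<beta> borel snd = P" by (simp add: B.distr_pair_fst)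
  then have "\<beta> \<in> couplings Q P"
    using \<beta> \<beta>.prob_space_axioms by (simp add: couplings_def Q_def)
  then have "wasserstein1 P Q \<le> (\<integral>\<^sup>+ z. ennreal (norm (fst z - snd z)) \<partial>\<beta>)"
    unfolding wasserstein1_def by (rule INF_lower)
  also have "\<dots> = ennreal (p * norm v)"
    using p by (subst int) (simp_all add: P.emeasure_space_1 ennreal_mult)
  finally have W: "wasserstein1 P Q \<le> ennreal (p * norm v)" .
  show ?thesis
  proof (rule that[of Q])
    show "borel_distribution Q"
      unfolding borel_distribution_def Q_def by (auto intro!: \<beta>.prob_space_distr)
    show "wasserstein1 P Q \<le> ennreal (p * norm v)" by (rule W)
    fix f :: "'a \<Rightarrow> ennreal"
    assume [measurable]: "f \<in> borel_measurable borel"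
    show "(\<integral>\<^sup>+ x. f x \<partial>Q)
        = ennreal (1 - p) * (\<integral>\<^sup>+ x. f x \<partial>P) + ennreal p * (\<integral>\<^sup>+ x. f (x + v) \<partial>P)"
      unfolding Q_def by (subst nn_integral_distr) (simp_all add: int)
  qed
qed

text \<open>
  The error term vanishes as \<open>p\<close> tends to \<open>0\<close>. It is added to the larger side because \<^typ>\<open>ennreal\<close> has only
  truncated subtraction.
\<close>

lemma partial_translation_bound:
  fixes K :: "'a::euclidean_space set"
  assumes P: "borel_distribution P" and K: "0 < kernel_radius K"
    and R: "K \<subseteq> cball 0 R" "0 < R"
    and \<epsilon>: "0 \<le> \<epsilon>" and u: "norm u = 1" and p: "0 < p" "p \<le> 1"
  shows "ennreal (1 - p) * (\<integral>\<^sup>+ x. star_gauge K x \<partial>P) + ennreal \<epsilon> * inverse (radial_fun K u)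
    \<le> (SUP Q \<in> {Q. borel_distribution Q \<and> wasserstein1 P Q \<le> ennreal \<epsilon>}. \<integral>\<^sup>+ x. star_gauge K x \<partial>Q)
      + ennreal p * (ennreal R * star_Lip K * (\<integral>\<^sup>+ x. star_gauge K x \<partial>P))"
    (is "_ + _ \<le> ?S + _")
proof -
  obtain s where s: "0 < s" "cball 0 s \<subseteq> star_kernel K"
    using K by (auto simp: kernel_radius_def less_SUP_iff)
  note [measurable] = borel_measurable_star_gauge[OF s]
  interpret P: prob_space P using P by (simp add: borel_distribution_def)
  have [measurable_cong]: "sets P = sets borel" using P by (simp add: borel_distribution_def)
  \<comment> \<open>The length is chosen so that \<open>p * norm v\<close> is exactly
    \<open>\<epsilon>\<close>: the whole transport budget is spent on the moved fraction.\<close>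
  define v where "v = (\<epsilon> / p) *\<^sub>R u"
  obtain Q where Q: "borel_distribution Q" "wasserstein1 P Q \<le> ennreal (p * norm v)"
    and int: "\<And>f. f \<in> borel_measurable borel \<Longrightarrow>
      (\<integral>\<^sup>+ x. f x \<partial>Q) = ennreal (1 - p) * (\<integral>\<^sup>+ x. f x \<partial>P) + ennreal p * (\<integral>\<^sup>+ x. f (x + v) \<partial>P)"
    using exists_partial_translation[OF P, of p v] p by auto
  have "p * norm v = \<epsilon>" using p u \<epsilon> by (simp add: v_def)
  then have Q_le: "(\<integral>\<^sup>+ x. star_gauge K x \<partial>Q) \<le> ?S"
    using Q by (intro SUP_upper) auto
  \<comment> \<open>Comparing \<open>x + v\<close> with \<open>v\<close> costs at most
    \<open>norm x\<close> times the Lipschitz constant, whatever the length of \<open>v\<close>;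
    \<open>norm x\<close> is in turn at most \<open>R\<close> times the gauge of
    \<open>x\<close>.\<close>
  have pt: "star_gauge K v \<le> star_gauge K (x + v) + ennreal R * star_Lip K * star_gauge K x" for x
  proof -
    have "ennreal (norm x) = ennreal R * ennreal (norm x / R)"
      using R by (simp add: ennreal_mult[symmetric])
    also have "\<dots> \<le> ennreal R * star_gauge K x"
      by (intro mult_left_mono norm_le_star_gauge R) auto
    finally have "ennreal (norm x) * star_Lip K \<le> ennreal R * star_gauge K x * star_Lip K"
      by (intro mult_right_mono) auto
    moreover have "star_gauge K v \<le> star_gauge K (x + v) + ennreal (norm x) * star_Lip K"
      using star_gauge_add_le_Lip[OF K, of "x + v" "- x"] by simp
    ultimately show ?thesis
      by (metis add_left_mono mult.assoc mult.commute order_trans)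
  qed
  have "star_gauge K v = (\<integral>\<^sup>+ x. star_gauge K v \<partial>P)"
    by (simp add: P.emeasure_space_1)
  also have "\<dots> \<le> (\<integral>\<^sup>+ x. star_gauge K (x + v) + ennreal R * star_Lip K * star_gauge K x \<partial>P)"
    by (intro nn_integral_mono pt)
  also have "\<dots> = (\<integral>\<^sup>+ x. star_gauge K (x + v) \<partial>P) + ennreal R * star_Lip K * (\<integral>\<^sup>+ x. star_gauge K x \<partial>P)"
    by (simp add: nn_integral_add nn_integral_cmult)
  finally have v_le: "star_gauge K v \<le> \<dots>" .
  \<comment> \<open>The weight \<open>p\<close> cancels against the length
    \<open>\<epsilon> / p\<close>, so the gain does not depend on \<open>p\<close>.\<close>
  have "ennreal \<epsilon> * inverse (radial_fun K u)
      = ennreal p * (ennreal (\<epsilon> / p) * inverse (radial_fun K u))"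
    using p \<epsilon> by (simp add: mult.assoc[symmetric] ennreal_mult[symmetric])
  also have "\<dots> \<le> ennreal p * star_gauge K v"
    unfolding v_def using p \<epsilon> u by (intro mult_left_mono le_star_gauge_scaleR) auto
  also have "\<dots> \<le> ennreal p * ((\<integral>\<^sup>+ x. star_gauge K (x + v) \<partial>P)
      + ennreal R * star_Lip K * (\<integral>\<^sup>+ x. star_gauge K x \<partial>P))"
    by (intro mult_left_mono v_le) auto
  finally have "ennreal (1 - p) * (\<integral>\<^sup>+ x. star_gauge K x \<partial>P) + ennreal \<epsilon> * inverse (radial_fun K u)
      \<le> ennreal (1 - p) * (\<integral>\<^sup>+ x. star_gauge K x \<partial>P) + ennreal p * ((\<integral>\<^sup>+ x. star_gauge K (x + v) \<partial>P)
        + ennreal R * star_Lip K * (\<integral>\<^sup>+ x. star_gauge K x \<partial>P))"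
    by (rule add_left_mono)
  also have "\<dots> = (\<integral>\<^sup>+ x. star_gauge K x \<partial>Q)
      + ennreal p * (ennreal R * star_Lip K * (\<integral>\<^sup>+ x. star_gauge K x \<partial>P))"
    by (simp add: int distrib_left add.assoc)
  also have "\<dots> \<le> ?S + ennreal p * (ennreal R * star_Lip K * (\<integral>\<^sup>+ x. star_gauge K x \<partial>P))"
    by (intro add_right_mono Q_le)
  finally show ?thesis .
qed

text \<open>Adding \<open>p * a\<close> to both sides restores \<open>a\<close> on the left and
  leaves the error \<open>p * (a + d)\<close> on the right, which is arbitrarily small when
  \<open>a\<close> is finite. For infinite \<open>a\<close> the error may be infinite for every
  \<open>p\<close>, so \<open>c = top\<close> is then a separate hypothesis.\<close>

lemma ennreal_le_of_small_perturbation: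
  fixes a b c d :: ennreal
  assumes *: "\<And>p::real. 0 < p \<Longrightarrow> p < 1 \<Longrightarrow> ennreal (1 - p) * a + b \<le> c + ennreal p * d"
    and d: "a < top \<Longrightarrow> d < top"
    and top: "a = top \<Longrightarrow> c = top"
  shows "a + b \<le> c"
proof (cases "a = top")
  case False
  then have "a + d < top" using d by (simp add: less_top)
  then obtain m where m: "a + d = ennreal m" "0 \<le> m" by (cases "a + d") auto
  show ?thesis
  proof (rule ennreal_le_epsilon)
    fix e :: real
    assume e: "0 < e"
    \<comment> \<open>The bound \<open>1 / 2\<close> keeps \<open>p\<close> below \<open>1\<close>;
      the denominator \<open>m + 1\<close> stays positive even for \<open>m = 0\<close> and still
      yields \<open>p * m \<le> e\<close>.\<close>
    define p where "p = min (1 / 2) (e / (m + 1))"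
    have p: "0 < p" "p < 1" using e m by (auto simp: p_def)
    have "p * m \<le> e / (m + 1) * m" using m by (intro mult_right_mono) (auto simp: p_def)
    also have "\<dots> \<le> e" using e m by (simp add: field_simps)
    finally have pm: "p * m \<le> e" .
    have "a = ennreal (1 - p) * a + ennreal p * a"
      using p by (simp add: distrib_right[symmetric] ennreal_plus[symmetric] del: ennreal_plus)
    then have "a + b = (ennreal (1 - p) * a + b) + ennreal p * a"
      by (metis add.assoc add.commute)
    also have "\<dots> \<le> (c + ennreal p * d) + ennreal p * a"
      by (intro add_right_mono * p)
    also have "\<dots> = c + ennreal p * (a + d)"
      by (simp add: distrib_left ac_simps)
    also have "\<dots> = c + ennreal (p * m)"
      using p m by (simp add: ennreal_mult)
    also have "\<dots> \<le> c + ennreal e"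
      by (intro add_left_mono ennreal_leI pm)
    finally show "a + b \<le> c + ennreal e" .
  qed
qed (use top in simp)

section \<open>Worst-case expectation over the Wasserstein ball\<close>

theorem proposition3p4:
  fixes P :: "'a::euclidean_space measure"
    and K :: "'a set"
    and \<epsilon> :: real
  assumes "borel_distribution P"
    and "star_body K"
    and "inner_radius K = kernel_radius K"
    and "kernel_radius K > 0"
    and "\<epsilon> \<ge> 0"
  shows "(SUP Q \<in> {Q. borel_distribution Q \<and> wasserstein1 P Q \<le> ennreal \<epsilon>}.
            \<integral>\<^sup>+ x. star_gauge K x \<partial>Q)
         = (\<integral>\<^sup>+ x. star_gauge K x \<partial>P) + ennreal \<epsilon> * star_Lip K"
    (is "?S = ?A + _")
proof (rule antisym)
  show "?S \<le> ?A + ennreal \<epsilon> * star_Lip K"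
  proof (rule SUP_least)
    fix Q
    assume "Q \<in> {Q. borel_distribution Q \<and> wasserstein1 P Q \<le> ennreal \<epsilon>}"
    then have W: "wasserstein1 P Q \<le> ennreal \<epsilon>" by simp
    then have "(\<integral>\<^sup>+ x. star_gauge K x \<partial>Q) \<le> ?A + star_Lip K * wasserstein1 P Q"
      by (intro nn_integral_star_gauge_le_wasserstein1 assms) (auto intro: le_less_trans)
    also have "\<dots> \<le> ?A + star_Lip K * ennreal \<epsilon>"
      using W by (intro add_left_mono mult_left_mono) auto
    finally show "(\<integral>\<^sup>+ x. star_gauge K x \<partial>Q) \<le> ?A + ennreal \<epsilon> * star_Lip K"
      by (simp add: mult.commute)
  qed
next
  have "bounded K" using assms by (simp add: star_body_def compact_imp_bounded)
  then obtain R where "0 < R" "\<forall>x\<in>K. norm x \<le> R"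
    by (auto simp: bounded_pos)
  then have R: "0 < R" "K \<subseteq> cball 0 R" by auto
  have Lip: "star_Lip K < top"
    using assms by (simp add: star_Lip_eq_inverse_kernel_radius less_top[symmetric])
  have bound: "ennreal (1 - p) * ?A + ennreal \<epsilon> * inverse (radial_fun K u)
      \<le> ?S + ennreal p * (ennreal R * star_Lip K * ?A)"
    if "u \<in> sphere 0 1" "0 < p" "p < 1" for u p
    using that by (intro partial_translation_bound assms R) auto
  \<comment> \<open>Here the error term in \<open>bound\<close> is infinite too and gives no
    information. The translation with \<open>p = 0\<close> supplies instead an admissible
    \<open>Q\<close> at distance \<open>0\<close> with the same gauge integral.\<close>
  have top: "?S = top" if A: "?A = top"
  proof -
    obtain Q where Q: "borel_distribution Q" "wasserstein1 P Q \<le> 0"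
      and int: "\<And>f. f \<in> borel_measurable borel \<Longrightarrow>
        (\<integral>\<^sup>+ x. f x \<partial>Q) = (\<integral>\<^sup>+ x. f x \<partial>P)"
      using exists_partial_translation[OF assms(1), of 0 0] by auto
    obtain s where "0 < s" "cball 0 s \<subseteq> star_kernel K"
      using assms by (auto simp: kernel_radius_def less_SUP_iff)
    then have "(\<integral>\<^sup>+ x. star_gauge K x \<partial>Q) = top"
      using int[OF borel_measurable_star_gauge] A by simp
    moreover have "(\<integral>\<^sup>+ x. star_gauge K x \<partial>Q) \<le> ?S"
      using Q by (intro SUP_upper) auto
    ultimately show ?thesis by (simp add: top_unique)
  qed
  \<comment> \<open>The direction stays fixed while \<open>p\<close> tends to \<open>0\<close>; the
    supremum over directions is taken only afterwards.\<close>
  have "?A + ennreal \<epsilon> * inverse (radial_fun K u) \<le> ?S" if "u \<in> sphere 0 1" for u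
  proof (rule ennreal_le_of_small_perturbation)
    show "ennreal (1 - p) * ?A + ennreal \<epsilon> * inverse (radial_fun K u)
        \<le> ?S + ennreal p * (ennreal R * star_Lip K * ?A)" if "0 < p" "p < 1" for p
      by (rule bound) fact+
    show "ennreal R * star_Lip K * ?A < top" if "?A < top"
      using that Lip by (simp add: ennreal_mult_less_top)
    show "?S = top" if "?A = top"
      using that by (rule top)
  qed
  then have "(SUP u\<in>sphere 0 1. ?A + ennreal \<epsilon> * inverse (radial_fun K u)) \<le> ?S"
    by (rule SUP_least)
  moreover have "(sphere 0 1 :: 'a set) \<noteq> {}" using vector_choose_size[of 1] by auto
  \<comment> \<open>The equality of the two radii enters here: it identifies the best gain over all
    directions with the constant of the upper bound.\<close>
  moreover have "star_Lip K = (SUP u\<in>sphere 0 1. inverse (radial_fun K u))"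
    using assms by (simp add: star_Lip_eq_inverse_kernel_radius flip: inverse_inner_radius)
  ultimately show "?A + ennreal \<epsilon> * star_Lip K \<le> ?S"
    by (simp only: SUP_mult_left_ennreal ennreal_SUP_add_right not_False_eq_True)
qed

end
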